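(* Let $m>0$, $n>0$, $k>0$ be real numbers, let $\lambda=\lambda_1+i\lambda_2$ with $\lambda_1,\lambda_2\in\mathbb{R}$, and let $\alpha=\alpha_1+i\alpha_2$ with $\alpha_1,\alpha_2\in\mathbb{R}$ and $\alpha_1^2+\alpha_2^2\neq 0$. If $\alpha_1^2+\alpha_2^2<1$ and $\lambda_1\ge 0$, and if a solution of Problem 1 (defined in the context, with these parameters) exists, then it is unique; that is, any two solutions of Problem 1 coincide on $\overline{\Omega}$.
   Context: Let $\Omega=\{(x,y,t)\in\mathbb{R}^3: 0<x<1,\ 0<y<1,\ 0<t<1\}$ be the open unit cube, with faces $S_1=\{t=0,\ 0<x<1,\ 0<y<1\}$, $S_2=\{x=1,\ 0<y<1,\ 0<t<1\}$, $S_3=\{y=0,\ 0<x<1,\ 0<t<1\}$, $S_4=\{x=0,\ 0<y<1,\ 0<t<1\}$, $S_5=\{y=1,\ 0<x<1,\ 0<t<1\}$, $S_6=\{t=1,\ 0<x<1,\ 0<y<1\}$. Problem 1: find a complex-valued function $u(x,y,t)$ such that (1) $u\in C(\overline{\Omega})\cap C^{2,2,1}_{x,y,t}(\Omega)$, i.e. $u$ is continuous on $\overline\Omega$ and is twice continuously differentiable in $x$, twice in $y$ and once in $t$ in the open set $\Omega$; (2) $u$ satisfies in $\Omega$ the degenerate parabolic equation $$x^n y^m u_t = t^k y^m u_{xx} + t^k x^n u_{yy} - \lambda t^k x^n y^m u;$$ (3) $u=0$ on $S_2\cup S_3\cup S_4\cup S_5$; (4) $u(x,y,0)=\alpha\,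 u(x,y,1)$ for all $x,y\in[0,1]$ (non-local condition). *)

theory Defs
  imports "HOL-Analysis.Analysis"
begin

definition cube :: "(real \<times> real \<times> real) set" where
  "cube = {(x, y, t). 0 < x \<and> x < 1 \<and> 0 < y \<and> y < 1 \<and> 0 < t \<and> t < 1}"

definition S2 :: "(real \<times> real \<times> real) set" where
  "S2 = {(x, y, t). x = 1 \<and> 0 < y \<and> y < 1 \<and> 0 < t \<and> t < 1}"

definition S3 :: "(real \<times> real \<times> real) set" where
  "S3 = {(x, y, t). y = 0 \<and> 0 < x \<and> x < 1 \<and> 0 < t \<and> t < 1}"

definition S4 :: "(real \<times> real \<times> real) set" where
  "S4 = {(x, y, t). x = 0 \<and> 0 < y \<and> y < 1 \<and> 0 < t \<and> t < 1}"

definition S5 :: "(real \<times> real \<times> real) set" where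
  "S5 = {(x, y, t). y = 1 \<and> 0 < x \<and> x < 1 \<and> 0 < t \<and> t < 1}"

(* The value of vector_derivative is unspecified where the derivative does not exist;
   C221_on below asserts existence explicitly. *)

definition pd_x :: "(real \<times> real \<times> real \<Rightarrow> complex) \<Rightarrow> real \<times> real \<times> real \<Rightarrow> complex" where
  "pd_x u = (\<lambda>(x, y, t). vector_derivative (\<lambda>s. u (s, y, t)) (at x))"

definition pd_y :: "(real \<times> real \<times> real \<Rightarrow> complex) \<Rightarrow> real \<times> real \<times> real \<Rightarrow> complex" where
  "pd_y u = (\<lambda>(x, y, t). vector_derivative (\<lambda>s. u (x, s, t)) (at y))"

definition pd_t :: "(real \<times> real \<times> real \<Rightarrow> complex) \<Rightarrow> real \<times> real \<times> real \<Rightarrow> complex" where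
  "pd_t u = (\<lambda>(x, y, t). vector_derivative (\<lambda>s. u (x, y, s)) (at t))"

(* Intended for open D only. The pure derivatives u_x, u_xx, u_y, u_yy, u_t exist in D and are
   jointly continuous there; no mixed derivatives are required. *)

definition C221_on :: "(real \<times> real \<times> real) set \<Rightarrow> (real \<times> real \<times> real \<Rightarrow> complex) \<Rightarrow> bool" where
  "C221_on D u \<longleftrightarrow>
     (\<forall>x y t. (x, y, t) \<in> D \<longrightarrow>
        (\<lambda>s. u (s, y, t)) differentiable (at x) \<and>
        (\<lambda>s. pd_x u (s, y, t)) differentiable (at x) \<and>
        (\<lambda>s. u (x, s, t)) differentiable (at y) \<and>
        (\<lambda>s. pd_y u (x, s, t)) differentiable (at y) \<and>
        (\<lambda>s. u (x, y, s)) differentiable (at t)) \<and>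
     continuous_on D (pd_x u) \<and> continuous_on D (pd_x (pd_x u)) \<and>
     continuous_on D (pd_y u) \<and> continuous_on D (pd_y (pd_y u)) \<and>
     continuous_on D (pd_t u)"

definition solves_problem1 ::
  "real \<Rightarrow> real \<Rightarrow> real \<Rightarrow> complex \<Rightarrow> complex \<Rightarrow> (real \<times> real \<times> real \<Rightarrow> complex) \<Rightarrow> bool" where
  "solves_problem1 m n k lam \<alpha> u \<longleftrightarrow>
     continuous_on (closure cube) u \<and>
     C221_on cube u \<and>
     (\<forall>x y t. (x, y, t) \<in> cube \<longrightarrow>
        of_real (x powr n * y powr m) * pd_t u (x, y, t) =
          of_real (t powr k * y powr m) * pd_x (pd_x u) (x, y, t)
          + of_real (t powr k * x powr n) * pd_y (pd_y u) (x, y, t)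
          - lam * of_real (t powr k * x powr n * y powr m) * u (x, y, t)) \<and>
     (\<forall>p \<in> S2 \<union> S3 \<union> S4 \<union> S5. u p = 0) \<and>
     (\<forall>x \<in> {0..1}. \<forall>y \<in> {0..1}. u (x, y, 0) = \<alpha> * u (x, y, 1))"

end

(* Maximum principle for the modulus of the difference w = u - v.  Suppose |w| - e t with e > 0 has
   its maximum over [0,1]^2 x [0,T], T < 1, at an interior point p0 or on its top face, with
   w(p0) = c0 nonzero.  Put c = cnj c0.  The real-linear function Re (c w) is bounded by |c| |w|,
   with equality at p0, so Re (c w_xx) and Re (c w_yy) are nonpositive and Re (c w_t) >= e |c| > 0
   there, which contradicts the equation as lam1 >= 0.  So the maximum is governed by t = 0, where
   the non-local condition gives |w| <= |alpha| max |w|.  Letting e tend to 0 and T to 1 yields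
   max |w| <= |alpha| max |w|, hence w = 0.  Working with T < 1 avoids t = 1, where no t-derivative
   is available. *)
theory Submission
  imports Defs
begin

lemma closure_cube: "closure cube = {0..1} \<times> {0..1} \<times> {0..1}"
proof -
  have cube: "cube = {0<..<1} \<times> {0<..<1} \<times> {0<..<1}"
    by (auto simp: cube_def)
  show ?thesis
    unfolding cube closure_Times by simp
qed

section \<open>Derivative tests at a maximum in one real variable\<close>

text \<open>If \<open>g''\<close> were positive, \<open>g'\<close> would vanish at \<open>z\<close>
  and be positive just to its right, so by the mean value theorem \<open>g\<close> would exceed
  \<open>g z\<close> there. Differentiability of \<open>g'\<close> at the single point
  \<open>z\<close> suffices.\<close>

lemma second_derivative_nonpos_at_max:
  fixes g g' :: "real \<Rightarrow> real"
  assumes "a < z" "z < b"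
    and g: "\<And>s. a < s \<Longrightarrow> s < b \<Longrightarrow> (g has_real_derivative g' s) (at s)"
    and g': "(g' has_real_derivative g'') (at z)"
    and max: "\<And>s. a < s \<Longrightarrow> s < b \<Longrightarrow> g s \<le> g z"
  shows "g'' \<le> 0"
proof (rule ccontr)
  assume "\<not> g'' \<le> 0"
  then obtain d where d: "d > 0" "\<And>h. 0 < h \<Longrightarrow> h < d \<Longrightarrow> g' z < g' (z + h)"
    using DERIV_pos_inc_right[OF g'] by auto
  have "g' z = 0"
  proof (rule DERIV_local_max[OF g])
    show "0 < min (z - a) (b - z)" using assms(1,2) by simp
    show "\<forall>y. \<bar>z - y\<bar> < min (z - a) (b - z) \<longrightarrow> g y \<le> g z"
      using max by (auto simp: abs_if split: if_splits)
  qed (use assms in auto)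
  \<comment> \<open>Halving makes \<open>h\<close> strictly smaller than both \<open>d\<close> and
    \<open>b - z\<close>.\<close>
  define h where "h = min d (b - z) / 2"
  have h: "0 < h" "h < d" "z + h < b"
    using d(1) assms(2) by (auto simp: h_def min_def field_simps)
  obtain y where y: "z < y" "y < z + h" "g (z + h) - g z = h * g' y"
    using MVT2[of z "z + h" g g'] g h assms(1) by auto
  have "g' y > 0"
    using d(2)[of "y - z"] y h \<open>g' z = 0\<close> by auto
  then have "g (z + h) > g z"
    using mult_pos_pos[OF h(1)] y(3) by fastforce
  then show False
    using max[of "z + h"] h assms(1) by simp
qed

text \<open>A slope below \<open>e\<close> would make \<open>g s - e * s\<close> strictly larger
  just before \<open>z\<close>. Only earlier points are compared, so the test also applies on the
  top face of a box.\<close>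

lemma derivative_ge_at_right_max:
  fixes g :: "real \<Rightarrow> real"
  assumes "a < z"
    and g: "(g has_real_derivative g') (at z)"
    and max: "\<And>s. a < s \<Longrightarrow> s < z \<Longrightarrow> g s - e * s \<le> g z - e * z"
  shows "e \<le> g'"
proof (rule ccontr)
  assume "\<not> e \<le> g'"
  moreover have "((\<lambda>s. g s - e * s) has_real_derivative (g' - e)) (at z)"
    by (auto intro!: derivative_eq_intros g)
  ultimately obtain d where d: "d > 0"
      "\<And>h. 0 < h \<Longrightarrow> h < d \<Longrightarrow> g z - e * z < g (z - h) - e * (z - h)"
    using DERIV_neg_dec_left[of "\<lambda>s. g s - e * s" "g' - e" z] by auto
  define h where "h = min d (z - a) / 2"
  have "0 < h" "h < d" "h < z - a"
    using d(1) assms(1) by (auto simp: h_def min_def field_simps)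
  then show False
    using d(2)[of h] max[of "z - h"] by force
qed

section \<open>Derivatives and lateral boundary values of solutions\<close>

lemma has_real_derivative_Re_mult:
  assumes "(f has_vector_derivative f') (at x)"
  shows "((\<lambda>s. Re (c * f s)) has_real_derivative Re (c * f')) (at x)"
proof -
  have "bounded_linear (\<lambda>z. Re (c * z))"
    by (intro bounded_linear_compose[OF bounded_linear_Re] bounded_linear_mult_right)
  then show ?thesis
    using bounded_linear.has_vector_derivative assms
      has_real_derivative_iff_has_vector_derivative by blast
qed

lemma C221_on_has_derivatives:
  assumes "C221_on D u" "(x, y, t) \<in> D"
  shows "((\<lambda>s. u (s, y, t)) has_vector_derivative pd_x u (x, y, t)) (at x)"
    and "((\<lambda>s. pd_x u (s, y, t)) has_vector_derivative pd_x (pd_x u) (x, y, t)) (at x)"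
    and "((\<lambda>s. u (x, s, t)) has_vector_derivative pd_y u (x, y, t)) (at y)"
    and "((\<lambda>s. pd_y u (x, s, t)) has_vector_derivative pd_y (pd_y u) (x, y, t)) (at y)"
    and "((\<lambda>s. u (x, y, s)) has_vector_derivative pd_t u (x, y, t)) (at t)"
proof -
  have d: "(\<lambda>s. u (s, y, t)) differentiable (at x)"
    "(\<lambda>s. pd_x u (s, y, t)) differentiable (at x)"
    "(\<lambda>s. u (x, s, t)) differentiable (at y)"
    "(\<lambda>s. pd_y u (x, s, t)) differentiable (at y)"
    "(\<lambda>s. u (x, y, s)) differentiable (at t)"
    using assms unfolding C221_on_def by blast+
  have p: "vector_derivative (\<lambda>s. u (s, y, t)) (at x) = pd_x u (x, y, t)"
    "vector_derivative (\<lambda>s. pd_x u (s, y, t)) (at x) = pd_x (pd_x u) (x, y, t)"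
    "vector_derivative (\<lambda>s. u (x, s, t)) (at y) = pd_y u (x, y, t)"
    "vector_derivative (\<lambda>s. pd_y u (x, s, t)) (at y) = pd_y (pd_y u) (x, y, t)"
    "vector_derivative (\<lambda>s. u (x, y, s)) (at t) = pd_t u (x, y, t)"
    by (simp_all add: pd_x_def pd_y_def pd_t_def)
  show "((\<lambda>s. u (s, y, t)) has_vector_derivative pd_x u (x, y, t)) (at x)"
    "((\<lambda>s. pd_x u (s, y, t)) has_vector_derivative pd_x (pd_x u) (x, y, t)) (at x)"
    "((\<lambda>s. u (x, s, t)) has_vector_derivative pd_y u (x, y, t)) (at y)"
    "((\<lambda>s. pd_y u (x, s, t)) has_vector_derivative pd_y (pd_y u) (x, y, t)) (at y)"
    "((\<lambda>s. u (x, y, s)) has_vector_derivative pd_t u (x, y, t)) (at t)"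
    using d[unfolded vector_derivative_works] unfolding p by blast+
qed

text \<open>The faces \<open>S2\<close> to \<open>S5\<close> are relatively open and omit the
  vertical edges of the cube. Continuity of the solution on the closed cube extends the zero
  boundary values to those edges.\<close>

lemma solves_problem1_lateral_zero:
  assumes sol: "solves_problem1 m n k lam \<alpha> u"
    and "x \<in> {0..1}" "y \<in> {0..1}" "0 < t" "t < 1"
    and lateral: "x = 0 \<or> x = 1 \<or> y = 0 \<or> y = 1"
  shows "u (x, y, t) = 0"
proof (cases "x = 0 \<or> x = 1")
  case True
  have zero: "u (x, s, t) = 0" if "s \<in> {0<..<1}" for s
    using sol True that assms(4,5) by (auto simp: solves_problem1_def S2_def S4_def)
  have cont: "continuous_on (closure cube) u"
    using sol by (simp add: solves_problem1_def)
  have "continuous_on {0..1} (\<lambda>s. u (x, s, t))"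
    using assms(2,4,5)
    by (intro continuous_on_compose2[OF cont] continuous_intros) (auto simp: closure_cube)
  \<comment> \<open>The open segment is dense in \<open>{0..1}\<close>, so its zero values reach the
    endpoints \<open>y = 0\<close> and \<open>y = 1\<close>, which are the edge points.\<close>
  then show ?thesis
    using continuous_constant_on_closure[of "{0<..<1::real}" "\<lambda>s. u (x, s, t)" 0 y] zero assms(3)
    by auto
next
  case False
  then show ?thesis
    using sol assms by (auto simp: solves_problem1_def S3_def S5_def)
qed

section \<open>Maximum principle for the modulus of the difference\<close>

text \<open>The point may lie on the top of the box where the maximum is taken, so \<open>max_t\<close> only compares
  with earlier times.\<close>

lemma no_positive_max_of_modulus_difference:
  assumes u: "solves_problem1 m n k lam \<alpha> u" and v: "solves_problem1 m n k lam \<alpha> v"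
    and "Re lam \<ge> 0" "e > 0"
    and p: "(x, y, t) \<in> cube"
    and nz: "u (x, y, t) \<noteq> v (x, y, t)"
    and max_x: "\<And>s. 0 < s \<Longrightarrow> s < 1 \<Longrightarrow>
        cmod (u (s, y, t) - v (s, y, t)) \<le> cmod (u (x, y, t) - v (x, y, t))"
    and max_y: "\<And>s. 0 < s \<Longrightarrow> s < 1 \<Longrightarrow>
        cmod (u (x, s, t) - v (x, s, t)) \<le> cmod (u (x, y, t) - v (x, y, t))"
    and max_t: "\<And>s. 0 < s \<Longrightarrow> s < t \<Longrightarrow>
        cmod (u (x, y, s) - v (x, y, s)) - e * s \<le> cmod (u (x, y, t) - v (x, y, t)) - e * t"
  shows False
proof -
  define c where "c = cnj (u (x, y, t) - v (x, y, t))"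
  have cpos: "cmod c > 0" using nz by (simp add: c_def)
  have cw: "c * (u (x, y, t) - v (x, y, t)) = of_real ((cmod c)\<^sup>2)"
    by (simp only: c_def complex_mod_cnj complex_norm_square mult.commute)
  have le: "Re (c * z) \<le> cmod c * cmod z" for z
    by (metis complex_Re_le_cmod norm_mult)
  have cp: "cmod (u (x, y, t) - v (x, y, t)) = cmod c"
    by (simp add: c_def del: complex_cnj_diff)
  have Recw: "Re (c * (u (x, y, t) - v (x, y, t))) = cmod c * cmod c"
    unfolding cw by (simp add: power2_eq_square)
  have pos: "0 < x" "x < 1" "0 < y" "y < 1" "0 < t" "t < 1"
    using p by (auto simp: cube_def)
  have Cu: "C221_on cube u" and Cv: "C221_on cube v"
    using u v by (auto simp: solves_problem1_def)
  note du = C221_on_has_derivatives[OF Cu] and dv = C221_on_has_derivatives[OF Cv]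
  have xx: "Re (c * (pd_x (pd_x u) (x, y, t) - pd_x (pd_x v) (x, y, t))) \<le> 0"
  proof (rule second_derivative_nonpos_at_max[OF pos(1,2)])
    show "((\<lambda>s. Re (c * (u (s, y, t) - v (s, y, t)))) has_real_derivative
        Re (c * (pd_x u (s, y, t) - pd_x v (s, y, t)))) (at s)" if "0 < s" "s < 1" for s
      using that pos by (intro has_real_derivative_Re_mult has_vector_derivative_diff du dv)
        (auto simp: cube_def)
    show "((\<lambda>s. Re (c * (pd_x u (s, y, t) - pd_x v (s, y, t)))) has_real_derivative
        Re (c * (pd_x (pd_x u) (x, y, t) - pd_x (pd_x v) (x, y, t)))) (at x)"
      using p by (intro has_real_derivative_Re_mult has_vector_derivative_diff du dv)
    show "Re (c * (u (s, y, t) - v (s, y, t))) \<le> Re (c * (u (x, y, t) - v (x, y, t)))"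
      if "0 < s" "s < 1" for s
      \<comment> \<open>The real part is at most \<open>cmod c\<close> times the modulus of the
        difference, hence at most \<open>cmod c * cmod c\<close>, which is its value at the maximum
        by \<open>Recw\<close>.\<close>
      using order_trans[OF le mult_left_mono[OF max_x[OF that, unfolded cp]]]
      by (simp only: Recw norm_ge_zero)
  qed
  have yy: "Re (c * (pd_y (pd_y u) (x, y, t) - pd_y (pd_y v) (x, y, t))) \<le> 0"
  proof (rule second_derivative_nonpos_at_max[OF pos(3,4)])
    show "((\<lambda>s. Re (c * (u (x, s, t) - v (x, s, t)))) has_real_derivative
        Re (c * (pd_y u (x, s, t) - pd_y v (x, s, t)))) (at s)" if "0 < s" "s < 1" for s
      using that pos by (intro has_real_derivative_Re_mult has_vector_derivative_diff du dv)
        (auto simp: cube_def)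
    show "((\<lambda>s. Re (c * (pd_y u (x, s, t) - pd_y v (x, s, t)))) has_real_derivative
        Re (c * (pd_y (pd_y u) (x, y, t) - pd_y (pd_y v) (x, y, t)))) (at y)"
      using p by (intro has_real_derivative_Re_mult has_vector_derivative_diff du dv)
    show "Re (c * (u (x, s, t) - v (x, s, t))) \<le> Re (c * (u (x, y, t) - v (x, y, t)))"
      if "0 < s" "s < 1" for s
      using order_trans[OF le mult_left_mono[OF max_y[OF that, unfolded cp]]]
      by (simp only: Recw norm_ge_zero)
  qed
  \<comment> \<open>Passing from the modulus to the real part multiplies the comparison by
    \<open>cmod c\<close>, so the slope \<open>e\<close> becomes \<open>cmod c * e\<close>.\<close>
  have tt: "cmod c * e \<le> Re (c * (pd_t u (x, y, t) - pd_t v (x, y, t)))"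
  proof (rule derivative_ge_at_right_max[OF pos(5)])
    show "((\<lambda>s. Re (c * (u (x, y, s) - v (x, y, s)))) has_real_derivative
        Re (c * (pd_t u (x, y, t) - pd_t v (x, y, t)))) (at t)"
      using p by (intro has_real_derivative_Re_mult has_vector_derivative_diff du dv)
    show "Re (c * (u (x, y, s) - v (x, y, s))) - cmod c * e * s
        \<le> Re (c * (u (x, y, t) - v (x, y, t))) - cmod c * e * t" if "0 < s" "s < t" for s
    proof -
      have "cmod c * cmod (u (x, y, s) - v (x, y, s)) \<le> cmod c * (cmod c - e * t + e * s)"
        using max_t[OF that] unfolding cp by (intro mult_left_mono) auto
      then show ?thesis
        using le[of "u (x, y, s) - v (x, y, s)"] unfolding Recw by (simp add: algebra_simps)
    qed
  qed
  \<comment> \<open>The equation degenerates only where a coordinate vanishes; inside the cube all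
    four weights are positive.\<close>
  define A B C D where "A = x powr n * y powr m" and "B = t powr k * y powr m"
    and "C = t powr k * x powr n" and "D = t powr k * x powr n * y powr m"
  have ABCD: "A > 0" "B > 0" "C > 0" "D > 0"
    using pos by (simp_all add: A_def B_def C_def D_def)
  have "of_real A * pd_t u (x, y, t) = of_real B * pd_x (pd_x u) (x, y, t)
      + of_real C * pd_y (pd_y u) (x, y, t) - lam * of_real D * u (x, y, t)"
    and "of_real A * pd_t v (x, y, t) = of_real B * pd_x (pd_x v) (x, y, t)
      + of_real C * pd_y (pd_y v) (x, y, t) - lam * of_real D * v (x, y, t)"
    using u v p unfolding solves_problem1_def A_def B_def C_def D_def by blast+
  then have "c * (of_real A * pd_t u (x, y, t)) - c * (of_real A * pd_t v (x, y, t))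
      = c * (of_real B * pd_x (pd_x u) (x, y, t) + of_real C * pd_y (pd_y u) (x, y, t)
          - lam * of_real D * u (x, y, t))
        - c * (of_real B * pd_x (pd_x v) (x, y, t) + of_real C * pd_y (pd_y v) (x, y, t)
          - lam * of_real D * v (x, y, t))"
    by (simp only:)
  then have "of_real A * (c * (pd_t u (x, y, t) - pd_t v (x, y, t)))
      = of_real B * (c * (pd_x (pd_x u) (x, y, t) - pd_x (pd_x v) (x, y, t)))
      + of_real C * (c * (pd_y (pd_y u) (x, y, t) - pd_y (pd_y v) (x, y, t)))
      - of_real D * (lam * (c * (u (x, y, t) - v (x, y, t))))"
    by (simp only: algebra_simps)
  \<comment> \<open>The zeroth-order term is \<open>lam\<close> times the real number
    \<open>D * (cmod c)\<^sup>2\<close>, so the imaginary part of \<open>lam\<close>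
    disappears.\<close>
  from arg_cong[OF this, of Re]
  have "A * Re (c * (pd_t u (x, y, t) - pd_t v (x, y, t)))
      = B * Re (c * (pd_x (pd_x u) (x, y, t) - pd_x (pd_x v) (x, y, t)))
      + C * Re (c * (pd_y (pd_y u) (x, y, t) - pd_y (pd_y v) (x, y, t)))
      - D * (Re lam * (cmod c)\<^sup>2)"
    unfolding cw by (simp only: minus_complex.sel plus_complex.sel times_complex.sel
        Re_complex_of_real Im_complex_of_real mult_zero_left mult_zero_right diff_0_right)
  moreover have "A * Re (c * (pd_t u (x, y, t) - pd_t v (x, y, t))) > 0"
    using tt ABCD(1) cpos \<open>e > 0\<close>
    by (meson less_le_trans mult_pos_pos)
  moreover have "B * Re (c * (pd_x (pd_x u) (x, y, t) - pd_x (pd_x v) (x, y, t))) \<le> 0"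
    "C * Re (c * (pd_y (pd_y u) (x, y, t) - pd_y (pd_y v) (x, y, t))) \<le> 0"
    "D * (Re lam * (cmod c)\<^sup>2) \<ge> 0"
    using xx yy ABCD \<open>Re lam \<ge> 0\<close>
    by (auto intro: mult_nonneg_nonpos simp del: times_complex.sel minus_complex.sel)
  ultimately show False by linarith
qed

text \<open>The penalised modulus is maximised over the box of height \<open>t\<close>. At the
  bottom, the non-local condition turns the bound \<open>M\<close> at time 1 into
  \<open>cmod \<alpha> * M\<close>; at a positive time the difference vanishes at the maximum.
  Removing the penalty costs at most \<open>e\<close>.\<close>

lemma modulus_difference_bound:
  assumes u: "solves_problem1 m n k lam \<alpha> u" and v: "solves_problem1 m n k lam \<alpha> v"
    and "Re lam \<ge> 0" "e > 0"
    and M: "\<And>p. p \<in> closure cube \<Longrightarrow> cmod (u p - v p) \<le> M"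
    and p: "x \<in> {0..1}" "y \<in> {0..1}" "0 \<le> t" "t < 1"
  shows "cmod (u (x, y, t) - v (x, y, t)) \<le> cmod \<alpha> * M + e"
proof -
  define K :: "(real \<times> real \<times> real) set" where "K = {0..1} \<times> {0..1} \<times> {0..t}"
  have "K \<subseteq> closure cube" using p by (auto simp: K_def closure_cube)
  moreover have "continuous_on (closure cube) u" "continuous_on (closure cube) v"
    using u v by (auto simp: solves_problem1_def)
  ultimately have "continuous_on K (\<lambda>p. cmod (u p - v p) - e * snd (snd p))"
    by (intro continuous_intros) (auto intro: continuous_on_subset)
  moreover have "compact K" by (simp add: K_def compact_Times)
  moreover have pK: "(x, y, t) \<in> K" using p by (simp add: K_def)
  ultimately obtain p0 where p0: "p0 \<in> K"
      "\<And>q. q \<in> K \<Longrightarrow> cmod (u q - v q) - e * snd (snd q)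
        \<le> cmod (u p0 - v p0) - e * snd (snd p0)"
    using continuous_attains_sup[of K "\<lambda>p. cmod (u p - v p) - e * snd (snd p)"] by blast
  obtain x0 y0 t0 where p0_eq: "p0 = (x0, y0, t0)" by (cases p0)
  have in0: "x0 \<in> {0..1}" "y0 \<in> {0..1}" "0 \<le> t0" "t0 \<le> t"
    using p0(1) by (auto simp: K_def p0_eq)
  have max: "cmod (u (a, b, s) - v (a, b, s)) - e * s
      \<le> cmod (u (x0, y0, t0) - v (x0, y0, t0)) - e * t0"
    if "a \<in> {0..1}" "b \<in> {0..1}" "0 \<le> s" "s \<le> t" for a b s
    using p0(2)[of "(a, b, s)"] that by (simp add: K_def p0_eq)
  have M0: "0 \<le> M"
    using p by (intro order_trans[OF norm_ge_zero M[of "(x, y, t)"]]) (auto simp: closure_cube)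
  have "cmod (u (x0, y0, t0) - v (x0, y0, t0)) \<le> cmod \<alpha> * M"
  proof (cases "t0 = 0")
    case True
    have "u (x0, y0, 0) = \<alpha> * u (x0, y0, 1)" "v (x0, y0, 0) = \<alpha> * v (x0, y0, 1)"
      using u v in0(1,2) by (auto simp: solves_problem1_def)
    then have "cmod (u (x0, y0, t0) - v (x0, y0, t0))
        = cmod \<alpha> * cmod (u (x0, y0, 1) - v (x0, y0, 1))"
      using True by (metis norm_mult right_diff_distrib)
    also have "\<dots> \<le> cmod \<alpha> * M"
      using M[of "(x0, y0, 1)"] in0 by (intro mult_left_mono) (auto simp: closure_cube)
    finally show ?thesis .
  next
    case False
    have t0: "0 < t0" "t0 < 1" using False in0 p by auto
    \<comment> \<open>On the lateral boundary both solutions vanish. Any other such point lies in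
      the open cube, even if \<open>t0 = t\<close>, because \<open>t < 1\<close>.\<close>
    have "u (x0, y0, t0) = v (x0, y0, t0)"
    proof (cases "x0 = 0 \<or> x0 = 1 \<or> y0 = 0 \<or> y0 = 1")
      case True
      then show ?thesis
        using solves_problem1_lateral_zero[OF u in0(1,2) t0]
          solves_problem1_lateral_zero[OF v in0(1,2) t0] by simp
    next
      case False
      then have c: "(x0, y0, t0) \<in> cube"
        using in0 t0 by (auto simp: cube_def)
      show ?thesis
      proof (rule ccontr)
        assume nz: "u (x0, y0, t0) \<noteq> v (x0, y0, t0)"
        show False
        proof (rule no_positive_max_of_modulus_difference[OF u v assms(3,4) c nz])
          show "cmod (u (s, y0, t0) - v (s, y0, t0)) \<le> cmod (u (x0, y0, t0) - v (x0, y0, t0))"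
            if "0 < s" "s < 1" for s
            using max[of s y0 t0] that in0 by simp
          show "cmod (u (x0, s, t0) - v (x0, s, t0)) \<le> cmod (u (x0, y0, t0) - v (x0, y0, t0))"
            if "0 < s" "s < 1" for s
            using max[of x0 s t0] that in0 by simp
          show "cmod (u (x0, y0, s) - v (x0, y0, s)) - e * s
              \<le> cmod (u (x0, y0, t0) - v (x0, y0, t0)) - e * t0"
            if "0 < s" "s < t0" for s
            using max[of x0 y0 s] that in0 by simp
        qed
      qed
    qed
    then show ?thesis using M0 by simp
  qed
  moreover have "e * t \<le> e" "0 \<le> e * t0"
    using p \<open>e > 0\<close> in0 by (auto simp: mult_left_le)
  ultimately show ?thesis
    using max[OF p(1,2,3) order_refl] by linarith
qed

section \<open>Uniqueness by contraction in the non-local condition\<close>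

theorem theorem1:
  fixes m n k lam1 lam2 \<alpha>1 \<alpha>2 :: real
    and u v :: "real \<times> real \<times> real \<Rightarrow> complex"
  assumes "m > 0" and "n > 0" and "k > 0"
    and "\<alpha>1\<^sup>2 + \<alpha>2\<^sup>2 \<noteq> 0"
    and "\<alpha>1\<^sup>2 + \<alpha>2\<^sup>2 < 1"
    and "lam1 \<ge> 0"
    and "solves_problem1 m n k (Complex lam1 lam2) (Complex \<alpha>1 \<alpha>2) u"
    and "solves_problem1 m n k (Complex lam1 lam2) (Complex \<alpha>1 \<alpha>2) v"
  shows "\<forall>p \<in> closure cube. u p = v p"
proof -
  define \<alpha> where "\<alpha> = Complex \<alpha>1 \<alpha>2"
  define w where "w p = cmod (u p - v p)" for p
  have \<alpha>1: "cmod \<alpha> < 1"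
    using assms(5) by (simp add: \<alpha>_def cmod_def)
  have cont: "continuous_on (closure cube) w"
    using assms(7,8) unfolding w_def solves_problem1_def by (intro continuous_intros) auto
  moreover have "compact (closure cube)" "closure cube \<noteq> {}"
    by (auto simp: closure_cube compact_Times)
  ultimately obtain p where p: "p \<in> closure cube" "\<And>q. q \<in> closure cube \<Longrightarrow> w q \<le> w p"
    using continuous_attains_sup[of "closure cube" w] by blast
  obtain x y t where p_eq: "p = (x, y, t)" by (cases p)
  have xyt: "x \<in> {0..1}" "y \<in> {0..1}" "t \<in> {0..1}"
    using p(1) by (auto simp: closure_cube p_eq)
  \<comment> \<open>Each \<open>s < 1\<close> is the top of an admissible box, and \<open>e\<close>
    is arbitrary. The time of the maximum point \<open>p\<close> may itself be 0 or 1 and is reached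
    afterwards by continuity.\<close>
  have below: "w (x, y, s) \<le> cmod \<alpha> * w p" if "s \<in> {0<..<1}" for s
  proof (rule field_le_epsilon)
    fix e :: real assume "0 < e"
    then show "w (x, y, s) \<le> cmod \<alpha> * w p + e"
      using modulus_difference_bound[OF assms(7,8), of e "w p" x y s] that xyt p(2) assms(6)
      by (auto simp: w_def \<alpha>_def)
  qed
  have "continuous_on {0..1} (\<lambda>s. w (x, y, s))"
    using xyt
    by (intro continuous_on_compose2[OF cont] continuous_intros) (auto simp: closure_cube)
  then have "w (x, y, t) \<le> cmod \<alpha> * w p"
    using continuous_le_on_closure[of "{0<..<1::real}" "\<lambda>s. w (x, y, s)" t "cmod \<alpha> * w p"]
      below xyt by auto
  \<comment> \<open>Since \<open>(x, y, t)\<close> is the maximum point, the bound compares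
    \<open>w p\<close> with itself, and \<open>cmod \<alpha> < 1\<close> leaves no positive
    value.\<close>
  then have "(1 - cmod \<alpha>) * w p \<le> 0"
    by (simp add: p_eq algebra_simps)
  then have "w p \<le> 0"
    using \<alpha>1 by (simp add: mult_le_0_iff)
  then show ?thesis
    using p(2) by (force simp: w_def)
qed

end
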